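(* Let $G=(V,E)$ be a finite (not necessarily decomposable) graph and $y\in(0,\infty)^V$. Let $\ell$ be a random variable valued in $\mathcal C_{G^*}$ with distribution $$\mathbb P(\ell=C)=\frac{\pi_C(y)}{\delta_G(y)},\qquad C\in\mathcal C_{G^*},$$ where $\pi_C(y)=\prod_{i\in C}y_i$. Let $\varepsilon\colon\mathcal C_{G^*}\to\mathbb N_{G,1}$ be the map such that $\varepsilon(C)$ counts the number of occurrences of each vertex of $V$ in $C$ (i.e. $\varepsilon(C)_i=1$ if $i\in C$ and $0$ otherwise). Then $\varepsilon(\ell)\sim\operatorname{mult}_G(1,y)$, that is, $$\mathbb P(\varepsilon(\ell)=n)=\binom{1}{n}_G\,y^n\,\delta_G(y)^{-1},\qquad n\in\mathbb N_{G,1}.$$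
   Context: $\mathbb N=\{0,1,2,\ldots\}$. $G=(V,E)$ is a finite undirected simple graph and $G^*$ its complement graph. A clique is a set of pairwise adjacent vertices ($\emptyset$ and singletons are cliques); $\mathcal C_{G^*}$ is the set of cliques of $G^*$ (equivalently, independent sets of $G$) and $\mathcal C_G^+$ is the set of maximal cliques of $G$. $\delta_G(y)=\sum_{C\in\mathcal C_{G^*}}\prod_{i\in C}y_i$. The coefficients $\binom{1}{n}_G$ are defined by $\delta_G(y)=\sum_{n\in\mathbb N^V}\binom{1}{n}_G y^n$, with $y^n=\prod_{i\in V}y_i^{n_i}$. $\mathbb N_{G,1}=\{n\in\mathbb N^V:\max_{C\in\mathcal C_G^+}\sum_{i\in C}n_i\le1\}$. *)

theory Defs
  imports "HOL-Probability.Probability" "HOL-Library.Ramsey" "HOL-Library.Poly_Mapping"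
begin

text \<open>
  A graph is given by its vertex set \<open>V\<close> and its set \<open>E\<close> of edges, which are two-element
  subsets of \<open>V\<close>; this is the encoding used by the predicate \<^const>\<open>clique\<close> of the library.
\<close>

definition finite_simple_graph :: "'a set \<Rightarrow> 'a set set \<Rightarrow> bool" where
  "finite_simple_graph V E \<longleftrightarrow> finite V \<and> E \<subseteq> [V]\<^bsup>2\<^esup>"

definition complement_edges :: "'a set \<Rightarrow> 'a set set \<Rightarrow> 'a set set" where
  "complement_edges V E = [V]\<^bsup>2\<^esup> - E"

definition cliques :: "'a set \<Rightarrow> 'a set set \<Rightarrow> 'a set set" where
  "cliques V E = {C. C \<subseteq> V \<and> clique C E}"

definition maximal_cliques :: "'a set \<Rightarrow> 'a set set \<Rightarrow> 'a set set" where
  "maximal_cliques V E = {C \<in> cliques V E. \<forall>D\<in>cliques V E. C \<subseteq> D \<longrightarrow> D = C}"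

text \<open>
  The graph polynomial \<open>\<delta>\<^sub>G\<close> is evaluated in an arbitrary commutative semiring, so that \<open>y\<close> may be
  a real vector or the family of indeterminates of a polynomial ring.
\<close>

definition graph_delta :: "'a set \<Rightarrow> 'a set set \<Rightarrow> ('a \<Rightarrow> 'b::comm_semiring_1) \<Rightarrow> 'b" where
  "graph_delta V E y = (\<Sum>C\<in>cliques V (complement_edges V E). \<Prod>i\<in>C. y i)"

text \<open>
  An element of \<open>\<nat>\<^sup>V\<close> is an \<open>n :: 'a \<Rightarrow>\<^sub>0 nat\<close> with \<open>Poly_Mapping.keys n \<subseteq> V\<close>, and
  \<open>('a \<Rightarrow>\<^sub>0 nat) \<Rightarrow>\<^sub>0 real\<close> is the ring of real polynomials in indeterminates indexed by \<open>'a\<close>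
  (multiplication is convolution), in which \<open>single (single i 1) 1\<close> is the indeterminate with index \<open>i\<close>.
\<close>

definition monomial_value :: "'a set \<Rightarrow> ('a \<Rightarrow> real) \<Rightarrow> ('a \<Rightarrow>\<^sub>0 nat) \<Rightarrow> real" where
  "monomial_value V y n = (\<Prod>i\<in>V. y i ^ Poly_Mapping.lookup n i)"

text \<open>
  \<open>graph_binom_one V E n\<close> is the graph binomial coefficient of 1 over \<open>n\<close>: the coefficient of \<open>y\<^sup>n\<close> in
  \<open>\<delta>\<^sub>G(y)\<close>.
\<close>

definition graph_binom_one :: "'a set \<Rightarrow> 'a set set \<Rightarrow> ('a \<Rightarrow>\<^sub>0 nat) \<Rightarrow> real" where
  "graph_binom_one V E n =
     Poly_Mapping.lookup (graph_delta V E (\<lambda>i. Poly_Mapping.single (Poly_Mapping.single i 1) 1)) n"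

definition multinomial_support_one :: "'a set \<Rightarrow> 'a set set \<Rightarrow> ('a \<Rightarrow>\<^sub>0 nat) set" where
  "multinomial_support_one V E =
     {n. Poly_Mapping.keys n \<subseteq> V \<and>
         (MAX C\<in>maximal_cliques V E. \<Sum>i\<in>C. Poly_Mapping.lookup n i) \<le> 1}"

text \<open>The distribution \<open>mult\<^sub>G(1,y)\<close> on \<open>\<nat>\<^bsub>G,1\<^esub>\<close>.\<close>

definition graph_multinomial_one ::
    "'a set \<Rightarrow> 'a set set \<Rightarrow> ('a \<Rightarrow> real) \<Rightarrow> ('a \<Rightarrow>\<^sub>0 nat) measure" where
  "graph_multinomial_one V E y =
     point_measure (multinomial_support_one V E)
       (\<lambda>n. ennreal (graph_binom_one V E n * monomial_value V y n * inverse (graph_delta V E y)))"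

text \<open>\<open>occurrences\<close> is the map \<open>\<epsilon>\<close>; it is meaningful for finite \<open>C\<close> only.\<close>

definition occurrences :: "'a set \<Rightarrow> 'a \<Rightarrow>\<^sub>0 nat" where
  "occurrences C = Abs_poly_mapping (\<lambda>i. if i \<in> C then 1 else 0)"

lemma lookup_occurrences:
  assumes "finite C"
  shows "Poly_Mapping.lookup (occurrences C) i = (if i \<in> C then 1 else 0)"
proof -
  have "{i. (if i \<in> C then 1 else 0 :: nat) \<noteq> 0} = C" by auto
  with assms show ?thesis by (simp add: occurrences_def)
qed

lemma prod_indeterminates:
  assumes "finite C"
  shows "(\<Prod>i\<in>C. Poly_Mapping.single (Poly_Mapping.single i 1) 1) =
    (Poly_Mapping.single (occurrences C) 1 :: ('a \<Rightarrow>\<^sub>0 nat) \<Rightarrow>\<^sub>0 real)"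
  using assms
proof (induction C)
  case empty
  have "occurrences {} = (0 :: 'a \<Rightarrow>\<^sub>0 nat)"
    by (rule poly_mapping_eqI) (simp add: lookup_occurrences)
  then show ?case by simp
next
  case (insert x C)
  have "occurrences (insert x C) = Poly_Mapping.single x 1 + occurrences C"
    using insert.hyps
    by (intro poly_mapping_eqI) (auto simp: lookup_occurrences lookup_add lookup_single when_def)
  with insert show ?case by (simp add: mult_single)
qed

text \<open>
  The identity \<open>\<delta>\<^sub>G(y) = \<Sum>\<^sub>n graph_binom_one V E n * y\<^sup>n\<close> for real \<open>y\<close>, where \<open>n\<close> ranges
  over the (finite) set of elements of \<open>\<nat>\<^sup>V\<close> with nonzero coefficient.
\<close>

lemma graph_delta_expansion:
  fixes V :: "'a set" and E :: "'a set set" and y :: "'a \<Rightarrow> real"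
  assumes "finite V"
  defines "S \<equiv> {n. graph_binom_one V E n \<noteq> 0}"
  shows "finite S" and "\<And>n. n \<in> S \<Longrightarrow> Poly_Mapping.keys n \<subseteq> V"
    and "graph_delta V E y = (\<Sum>n\<in>S. graph_binom_one V E n * monomial_value V y n)"
proof -
  let ?I = "cliques V (complement_edges V E)"
  have fin: "finite C" if "C \<in> ?I" for C
    using that assms(1) finite_subset by (auto simp: cliques_def)
  have finI: "finite ?I"
    using assms(1) by (auto simp: cliques_def intro: finite_subset[of _ "Pow V"])
  have coeff: "graph_binom_one V E n = (\<Sum>C\<in>?I. if occurrences C = n then 1 else 0)" for n
  proof -
    have "graph_delta V E (\<lambda>i. Poly_Mapping.single (Poly_Mapping.single i 1) 1) =
      (\<Sum>C\<in>?I. Poly_Mapping.single (occurrences C) (1::real))"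
      unfolding graph_delta_def by (intro sum.cong refl prod_indeterminates fin)
    then show ?thesis
      by (simp add: graph_binom_one_def lookup_sum lookup_single when_def)
  qed
  have sub: "S \<subseteq> occurrences ` ?I"
  proof
    fix n assume "n \<in> S"
    then have "(\<Sum>C\<in>?I. if occurrences C = n then 1 else 0 :: real) \<noteq> 0"
      by (simp add: S_def coeff)
    then obtain C where "C \<in> ?I" "(if occurrences C = n then 1 else 0 :: real) \<noteq> 0"
      by (rule sum.not_neutral_contains_not_neutral)
    then show "n \<in> occurrences ` ?I" by (metis imageI)
  qed
  show "finite S" using sub finI finite_surj by blast
  show "Poly_Mapping.keys n \<subseteq> V" if "n \<in> S" for n
  proof
    fix i assume i: "i \<in> Poly_Mapping.keys n"
    obtain C where C: "C \<in> ?I" "n = occurrences C" using sub \<open>n \<in> S\<close> by blast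
    with i fin[OF C(1)] have "i \<in> C"
      by (auto simp: in_keys_iff lookup_occurrences split: if_splits)
    with C(1) show "i \<in> V" by (auto simp: cliques_def)
  qed
  have mono: "monomial_value V y (occurrences C) = (\<Prod>i\<in>C. y i)" if "C \<in> ?I" for C
  proof -
    have "monomial_value V y (occurrences C) = (\<Prod>i\<in>V. if i \<in> C then y i else 1)"
      unfolding monomial_value_def
      by (intro prod.cong refl) (simp add: lookup_occurrences fin[OF that])
    also have "\<dots> = (\<Prod>i\<in>C. y i)"
      using that assms(1) by (simp add: prod.inter_restrict[symmetric] cliques_def Int_absorb1)
    finally show ?thesis .
  qed
  have "(\<Sum>n\<in>S. graph_binom_one V E n * monomial_value V y n) =
    (\<Sum>n\<in>occurrences ` ?I. graph_binom_one V E n * monomial_value V y n)"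
    by (rule sum.mono_neutral_left) (use sub finI in \<open>auto simp: S_def\<close>)
  also have "\<dots> = (\<Sum>n\<in>occurrences ` ?I. \<Sum>C\<in>?I. 
      if occurrences C = n then monomial_value V y n else 0)"
    unfolding coeff sum_distrib_right by (intro sum.cong refl) simp
  also have "\<dots> = (\<Sum>C\<in>?I. \<Sum>n\<in>occurrences ` ?I.
      if occurrences C = n then monomial_value V y n else 0)"
    by (rule sum.swap)
  also have "\<dots> = (\<Sum>C\<in>?I. monomial_value V y (occurrences C))"
    by (intro sum.cong refl) (simp add: finI)
  also have "\<dots> = graph_delta V E y"
    by (simp add: graph_delta_def mono)
  finally show "graph_delta V E y = (\<Sum>n\<in>S. graph_binom_one V E n * monomial_value V y n)" ..
qed

end

theory Submission
  imports Defs
begin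

text \<open>
  The map \<open>\<epsilon>\<close> is a bijection from the independent sets of \<open>G\<close> onto \<open>\<nat>\<^bsub>G,1\<^esub>\<close>. It is injective
  because \<open>C\<close> is the support of \<open>\<epsilon>(C)\<close>. A clique meets an independent set in at most one vertex, so
  \<open>\<epsilon>\<close> takes its values in \<open>\<nat>\<^bsub>G,1\<^esub>\<close>. Conversely, the bound 1 on the sum of \<open>n\<close> over every maximal
  clique passes to all cliques, since each of them extends to a maximal one and the terms are
  nonnegative. Applied to single vertices it makes \<open>n\<close> the indicator of its support, and applied to
  edges it makes this support independent (\<open>bij_betw_occurrences\<close>).

  The monomials \<open>\<pi>\<^sub>C\<close> of \<open>\<delta>\<^sub>G\<close> therefore have the pairwise distinct exponents \<open>\<epsilon>(C)\<close>, which gives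
  each of them the coefficient 1 (\<open>graph_binom_one_occurrences\<close>), and \<open>y\<close> raised to the power
  \<open>\<epsilon>(C)\<close> is \<open>\<pi>\<^sub>C(y)\<close> (\<open>monomial_value_occurrences\<close>). So the mass that \<open>mult\<^sub>G(1,y)\<close> gives to
  \<open>n = \<epsilon>(C)\<close> is \<open>\<pi>\<^sub>C(y) / \<delta>\<^sub>G(y)\<close>, which is the probability of \<open>\<ell> = C\<close>; by injectivity this is also
  the probability of \<open>\<epsilon>(\<ell>) = n\<close>. As \<open>\<nat>\<^bsub>G,1\<^esub>\<close> is finite, the point masses determine the law.
\<close>

lemma finite_cliques: "finite V \<Longrightarrow> finite (cliques V E)"
  by (auto simp: cliques_def intro: finite_subset[of _ "Pow V"])

lemma finite_clique: "finite V \<Longrightarrow> C \<in> cliques V E \<Longrightarrow> finite C"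
  by (auto simp: cliques_def intro: finite_subset)

lemma maximal_clique_extension:
  assumes "finite V" "C \<in> cliques V E"
  obtains D where "D \<in> maximal_cliques V E" "C \<subseteq> D"
  using finite_has_maximal2[OF finite_cliques[OF assms(1)] assms(2)]
  by (auto simp: maximal_cliques_def)

text \<open>
  The maximum over the maximal cliques equals the maximum over all cliques. The form with all
  cliques can be applied to vertices and to edges.
\<close>

lemma multinomial_support_one_iff:
  assumes "finite V"
  shows "n \<in> multinomial_support_one V E \<longleftrightarrow>
    Poly_Mapping.keys n \<subseteq> V \<and> (\<forall>C\<in>cliques V E. (\<Sum>i\<in>C. Poly_Mapping.lookup n i) \<le> 1)"
proof -
  have sub: "maximal_cliques V E \<subseteq> cliques V E" by (auto simp: maximal_cliques_def)
  then have fin: "finite (maximal_cliques V E)"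
    using finite_cliques[OF assms] by (rule finite_subset)
  have "{} \<in> cliques V E" by (simp add: cliques_def clique_def)
  then have ne: "maximal_cliques V E \<noteq> {}"
    using maximal_clique_extension[OF assms] by blast
  have "(\<forall>D\<in>maximal_cliques V E. (\<Sum>i\<in>D. Poly_Mapping.lookup n i) \<le> 1) \<longleftrightarrow>
    (\<forall>C\<in>cliques V E. (\<Sum>i\<in>C. Poly_Mapping.lookup n i) \<le> 1)" (is "?L \<longleftrightarrow> ?R")
  proof
    assume L: ?L
    show ?R
    proof
      fix C assume "C \<in> cliques V E"
      then obtain D where D: "D \<in> maximal_cliques V E" "C \<subseteq> D"
        using maximal_clique_extension[OF assms] by blast
      then have "(\<Sum>i\<in>C. Poly_Mapping.lookup n i) \<le> (\<Sum>i\<in>D. Poly_Mapping.lookup n i)"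
        using sub finite_clique[OF assms] by (intro sum_mono2) auto
      also have "\<dots> \<le> 1" using L D(1) by blast
      finally show "(\<Sum>i\<in>C. Poly_Mapping.lookup n i) \<le> 1" .
    qed
  qed (use sub in blast)
  with fin ne show ?thesis by (simp add: multinomial_support_one_def)
qed

lemma clique_Int_independent_le_1:
  assumes "finite V" "C \<in> cliques V (complement_edges V E)" "D \<in> cliques V E"
  shows "card (C \<inter> D) \<le> 1"
proof -
  have "i = j" if "i \<in> C \<inter> D" "j \<in> C \<inter> D" for i j
  proof (rule ccontr)
    assume "i \<noteq> j"
    then show False
      using that assms(2,3) unfolding cliques_def clique_def complement_edges_def by blast
  qed
  moreover have "finite (C \<inter> D)" using finite_clique[OF assms(1,2)] by simp
  ultimately show ?thesis by (auto simp: card_le_Suc0_iff_eq)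
qed

lemma keys_occurrences: "finite C \<Longrightarrow> Poly_Mapping.keys (occurrences C) = C"
  by (auto simp: in_keys_iff lookup_occurrences split: if_splits)

lemma inj_on_occurrences: "finite V \<Longrightarrow> inj_on occurrences (cliques V E)"
  by (rule inj_on_inverseI[of _ Poly_Mapping.keys]) (simp add: keys_occurrences finite_clique)

text \<open>
  The sum of \<open>\<epsilon>(C)\<close> over a clique \<open>D\<close> counts the vertices in \<open>C \<inter> D\<close>, and two distinct ones would
  be both adjacent and not adjacent.
\<close>

lemma occurrences_in_support:
  assumes "finite V" "C \<in> cliques V (complement_edges V E)"
  shows "occurrences C \<in> multinomial_support_one V E"
proof -
  have finC: "finite C" using finite_clique[OF assms] .
  have "(\<Sum>i\<in>D. Poly_Mapping.lookup (occurrences C) i) \<le> 1" if D: "D \<in> cliques V E" for D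
  proof -
    have "(\<Sum>i\<in>D. Poly_Mapping.lookup (occurrences C) i) = card (C \<inter> D)"
      using finite_clique[OF assms(1) D]
      by (simp add: lookup_occurrences finC sum.If_cases Int_commute)
    also have "\<dots> \<le> 1" by (rule clique_Int_independent_le_1[OF assms D])
    finally show ?thesis .
  qed
  moreover have "C \<subseteq> V" using assms(2) by (simp add: cliques_def)
  ultimately show ?thesis
    by (simp add: multinomial_support_one_iff assms(1) keys_occurrences finC)
qed

text \<open>
  Taking the support inverts \<open>\<epsilon>\<close>. The cliques with one vertex force the positive entries of \<open>n\<close> to
  equal 1, and an edge inside the support would then be a clique of sum 2.
\<close>

lemma support_keys_independent:
  assumes "finite V" "n \<in> multinomial_support_one V E"
  shows "Poly_Mapping.keys n \<in> cliques V (complement_edges V E)"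
    and "occurrences (Poly_Mapping.keys n) = n"
proof -
  have bound: "(\<Sum>i\<in>C. Poly_Mapping.lookup n i) \<le> 1" if "C \<in> cliques V E" for C
    using assms that by (simp add: multinomial_support_one_iff)
  have keys_V: "Poly_Mapping.keys n \<subseteq> V"
    using assms by (simp add: multinomial_support_one_iff)
  have one: "Poly_Mapping.lookup n i = 1" if "i \<in> Poly_Mapping.keys n" for i
  proof -
    have "{i} \<in> cliques V E" using that keys_V by (auto simp: cliques_def clique_def)
    then have "Poly_Mapping.lookup n i \<le> 1" using bound[of "{i}"] by simp
    moreover have "Poly_Mapping.lookup n i \<noteq> 0" using that by (simp add: in_keys_iff)
    ultimately show ?thesis by linarith
  qed
  show "occurrences (Poly_Mapping.keys n) = n"
    by (rule poly_mapping_eqI) (use one in \<open>auto simp: lookup_occurrences in_keys_iff\<close>)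
  have "{i, j} \<notin> E"
    if ij: "i \<in> Poly_Mapping.keys n" "j \<in> Poly_Mapping.keys n" "i \<noteq> j" for i j
  proof
    assume "{i, j} \<in> E"
    then have "{i, j} \<in> cliques V E"
      using ij keys_V by (auto simp: cliques_def clique_def insert_commute)
    then show False using bound[of "{i, j}"] one ij by simp
  qed
  then show "Poly_Mapping.keys n \<in> cliques V (complement_edges V E)"
    using keys_V by (auto simp: cliques_def clique_def complement_edges_def nsets_def)
qed

lemma bij_betw_occurrences:
  assumes "finite V"
  shows "bij_betw occurrences (cliques V (complement_edges V E)) (multinomial_support_one V E)"
proof -
  have "multinomial_support_one V E \<subseteq> occurrences ` cliques V (complement_edges V E)"
    by (rule subsetI, rule image_eqI[OF _ support_keys_independent(1)[OF assms]])
      (simp_all add: support_keys_independent(2)[OF assms])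
  with inj_on_occurrences[OF assms] show ?thesis
    by (auto simp: bij_betw_def occurrences_in_support assms)
qed

text \<open>
  The coefficient counts the independent sets with the given exponent. By injectivity of \<open>\<epsilon>\<close> there
  is only one.
\<close>

lemma graph_binom_one_occurrences:
  assumes "finite V" "C \<in> cliques V (complement_edges V E)"
  shows "graph_binom_one V E (occurrences C) = 1"
proof -
  let ?I = "cliques V (complement_edges V E)"
  have "graph_delta V E (\<lambda>i. Poly_Mapping.single (Poly_Mapping.single i 1) 1) =
    (\<Sum>D\<in>?I. Poly_Mapping.single (occurrences D) (1::real))"
    unfolding graph_delta_def
    by (intro sum.cong refl prod_indeterminates finite_clique[OF assms(1)])
  then have "graph_binom_one V E (occurrences C) =
    (\<Sum>D\<in>?I. if occurrences D = occurrences C then 1 else 0)"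
    by (simp add: graph_binom_one_def lookup_sum lookup_single when_def)
  also have "\<dots> = (\<Sum>D\<in>?I. if D = C then 1 else 0)"
    using inj_on_eq_iff[OF inj_on_occurrences[OF assms(1)] _ assms(2)]
    by (intro sum.cong[OF refl]) simp
  also have "\<dots> = 1" using assms(2) by (simp add: finite_cliques assms(1))
  finally show ?thesis .
qed

lemma monomial_value_occurrences:
  assumes "finite V" "C \<subseteq> V"
  shows "monomial_value V y (occurrences C) = (\<Prod>i\<in>C. y i)"
proof -
  have "monomial_value V y (occurrences C) = (\<Prod>i\<in>V. if i \<in> C then y i else 1)"
    using assms unfolding monomial_value_def
    by (intro prod.cong refl) (simp add: lookup_occurrences finite_subset)
  also have "\<dots> = (\<Prod>i\<in>C. y i)"
    using assms by (simp add: prod.inter_restrict[symmetric] Int_absorb1)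
  finally show ?thesis .
qed

theorem theorem4p3:
  fixes V :: "'a set" and E :: "'a set set" and y :: "'a \<Rightarrow> real"
    and M :: "'w measure" and l :: "'w \<Rightarrow> 'a set"
  assumes "finite_simple_graph V E"
    and "\<forall>i\<in>V. 0 < y i"
    and "prob_space M"
    and "l \<in> M \<rightarrow>\<^sub>M count_space (cliques V (complement_edges V E))"
    and "\<forall>C\<in>cliques V (complement_edges V E).
      \<P>(w in M. l w = C) = (\<Prod>i\<in>C. y i) / graph_delta V E y"
  shows "occurrences \<in> cliques V (complement_edges V E) \<rightarrow> multinomial_support_one V E \<and>
    (\<lambda>w. occurrences (l w)) \<in> M \<rightarrow>\<^sub>M count_space (multinomial_support_one V E) \<and>
    distr M (count_space (multinomial_support_one V E)) (\<lambda>w. occurrences (l w)) =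
      graph_multinomial_one V E y \<and>
    (\<forall>n\<in>multinomial_support_one V E.
      \<P>(w in M. occurrences (l w) = n) =
        graph_binom_one V E n * monomial_value V y n * inverse (graph_delta V E y))"
proof -
  interpret prob_space M by fact
  let ?I = "cliques V (complement_edges V E)" and ?N = "multinomial_support_one V E"
  let ?p = "\<lambda>n. graph_binom_one V E n * monomial_value V y n * inverse (graph_delta V E y)"
  have finV: "finite V" using assms(1) by (simp add: finite_simple_graph_def)
  note bij = bij_betw_occurrences[OF finV, of E]
  have finN: "finite ?N"
    using bij_betw_finite[OF bij] finite_cliques[OF finV] by simp
  have maps: "occurrences \<in> ?I \<rightarrow> ?N" using bij by (auto simp: bij_betw_def)
  have meas: "(\<lambda>w. occurrences (l w)) \<in> M \<rightarrow>\<^sub>M count_space ?N"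
    using maps by (intro measurable_compose[OF assms(4)]) (simp add: measurable_count_space_eq1)
  have l_in: "l w \<in> ?I" if "w \<in> space M" for w
    using measurable_space[OF assms(4) that] by simp
  have pmass: "\<P>(w in M. occurrences (l w) = n) = ?p n" if "n \<in> ?N" for n
  proof -
    obtain C where C: "C \<in> ?I" "n = occurrences C"
      using bij \<open>n \<in> ?N\<close> by (auto simp: bij_betw_def)
    have "{w \<in> space M. occurrences (l w) = n} = {w \<in> space M. l w = C}"
      using C l_in inj_on_eq_iff[OF inj_on_occurrences[OF finV] _ C(1)] by auto
    then have "\<P>(w in M. occurrences (l w) = n) = (\<Prod>i\<in>C. y i) / graph_delta V E y"
      using assms(5) C(1) by simp
    also have "\<dots> = ?p n"
      using C finV by (simp add: graph_binom_one_occurrences monomial_value_occurrences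
          cliques_def divide_inverse)
    finally show ?thesis .
  qed
  have "distr M (count_space ?N) (\<lambda>w. occurrences (l w)) = graph_multinomial_one V E y"
    unfolding graph_multinomial_one_def
  proof (rule measure_eqI_finite[OF _ _ finN])
    fix n assume n: "n \<in> ?N"
    have "(\<lambda>w. occurrences (l w)) -` {n} \<inter> space M = {w \<in> space M. occurrences (l w) = n}"
      by auto
    with n show "emeasure (distr M (count_space ?N) (\<lambda>w. occurrences (l w))) {n} =
      emeasure (point_measure ?N (\<lambda>n. ennreal (?p n))) {n}"
      by (simp add: emeasure_distr[OF meas] emeasure_eq_measure pmass
          emeasure_point_measure_finite finN)
  qed (simp_all add: sets_point_measure)
  with maps meas pmass show ?thesis by blast
qed

end
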